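(* Let $M\subset G$ be the Cartan model of the symmetric space $G/K$ defined by $\sigma$ and let $X\in\mathbb{K}^{n\times n}$ be a nonzero matrix. Then $$\Sigma(h_X^G)\cap M\subset\Sigma(h_X^M).$$
   Context: Let $\mathbb{K}$ be one of $\mathbb{R}$, $\mathbb{C}$, $\mathbb{H}$ (quaternions). For a matrix $A\in\mathbb{K}^{n\times n}$, $A^*$ denotes its conjugate transpose. $G$ is the identity component of the compact Lie group $O(n,\mathbb{K})=\{A\in\mathbb{K}^{n\times n}: AA^*=I\}$, i.e. $G=SO(n)$, $U(n)$ or $Sp(n)$. $\mathbb{K}^{n\times n}$ carries the real inner product $\langle Y,Z\rangle=\Re\operatorname{Tr}(Y^*Z)$ (real part of the trace). $\sigma\colon G\to G$ is an involutive automorphism which is the restriction of an involutive automorphism $\sigma\colon\mathbb{K}^{n\times n}\to\mathbb{K}^{n\times n}$ of unital (real) algebras satisfying $\sigma(Y^* )=\sigma(Y)^*$ for all $Y\in\mathbb{K}^{n\times n}$. $K=\{B\in G:\sigma(B)=B\}$ is the fixed point subgroup. The Cartan model of $G/K$ is the submanifold $M=\{B\sigma(B)^{-1}: B\in G\}\subset G$, i.e. the image of $G/K\to G$, $[B]\mapsto B\sigma(B)^{-1}$; it is the connected component of the identity of $N=\{B\in G:\sigma(B)=B^{-1}\}$. For $X\in\mathbb{K}^{n\times n}$ the height function is $h_X(Y)=\Re\operatorname{Tr}(XY)$, $Y\in\mathbb{K}^{n\times n}$; $h_X^G$ and $h_X^M$ denote its restrictions to $G$ and to $M$, and $\Sigma(f)$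 denotes the set of critical points of a smooth function $f$ on its domain manifold. *)

theory Defs
  imports "HOL-Analysis.Analysis"
begin

section \<open>Quaternions\<close>

datatype quat = Quat (q_re: real) (q_i: real) (q_j: real) (q_k: real)

lemma quat_eq_iff:
  "x = y \<longleftrightarrow> q_re x = q_re y \<and> q_i x = q_i y \<and> q_j x = q_j y \<and> q_k x = q_k y"
  by (auto intro: quat.expand)

instantiation quat :: ring_1
begin

definition zero_quat :: quat where "0 = Quat 0 0 0 0"

definition one_quat :: quat where "1 = Quat 1 0 0 0"

definition plus_quat :: "quat \<Rightarrow> quat \<Rightarrow> quat" where
  "x + y = Quat (q_re x + q_re y) (q_i x + q_i y) (q_j x + q_j y) (q_k x + q_k y)"

definition minus_quat :: "quat \<Rightarrow> quat \<Rightarrow> quat" where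
  "x - y = Quat (q_re x - q_re y) (q_i x - q_i y) (q_j x - q_j y) (q_k x - q_k y)"

definition uminus_quat :: "quat \<Rightarrow> quat" where
  "- x = Quat (- q_re x) (- q_i x) (- q_j x) (- q_k x)"

definition times_quat :: "quat \<Rightarrow> quat \<Rightarrow> quat" where
  "x * y = Quat
     (q_re x * q_re y - q_i x * q_i y - q_j x * q_j y - q_k x * q_k y)
     (q_re x * q_i y + q_i x * q_re y + q_j x * q_k y - q_k x * q_j y)
     (q_re x * q_j y - q_i x * q_k y + q_j x * q_re y + q_k x * q_i y)
     (q_re x * q_k y + q_i x * q_j y - q_j x * q_i y + q_k x * q_re y)"

instance
  by standard
    (simp_all add: quat_eq_iff zero_quat_def one_quat_def plus_quat_def minus_quat_def
      uminus_quat_def times_quat_def algebra_simps)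

end

instantiation quat :: real_vector
begin

definition scaleR_quat :: "real \<Rightarrow> quat \<Rightarrow> quat" where
  "r *\<^sub>R x = Quat (r * q_re x) (r * q_i x) (r * q_j x) (r * q_k x)"

instance
  by standard (simp_all add: quat_eq_iff scaleR_quat_def plus_quat_def algebra_simps)

end

instantiation quat :: real_inner
begin

definition inner_quat :: "quat \<Rightarrow> quat \<Rightarrow> real" where
  "x \<bullet> y = q_re x * q_re y + q_i x * q_i y + q_j x * q_j y + q_k x * q_k y"

definition norm_quat :: "quat \<Rightarrow> real" where
  "norm (x :: quat) = sqrt (x \<bullet> x)"

definition sgn_quat :: "quat \<Rightarrow> quat" where
  "sgn (x :: quat) = x /\<^sub>R norm x"

definition dist_quat :: "quat \<Rightarrow> quat \<Rightarrow> real" where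
  "dist (x :: quat) y = norm (x - y)"

definition uniformity_quat :: "(quat \<times> quat) filter" where
  "uniformity = (INF e\<in>{0<..}. principal {(x :: quat, y). dist x y < e})"

definition open_quat :: "quat set \<Rightarrow> bool" where
  "open (U :: quat set) \<longleftrightarrow> (\<forall>x\<in>U. \<forall>\<^sub>F (x', y) in uniformity. x' = x \<longrightarrow> y \<in> U)"

instance
proof
  fix x y z :: quat and r :: real and U :: "quat set"
  show "x \<bullet> y = y \<bullet> x" "(x + y) \<bullet> z = x \<bullet> z + y \<bullet> z" "(r *\<^sub>R x) \<bullet> y = r * (x \<bullet> y)" "0 \<le> x \<bullet> x"
    by (simp_all add: inner_quat_def scaleR_quat_def plus_quat_def algebra_simps)
  show "(x \<bullet> x = 0) = (x = 0)"
    by (simp add: inner_quat_def quat_eq_iff zero_quat_def add_nonneg_eq_0_iff)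
qed (rule sgn_quat_def dist_quat_def norm_quat_def uniformity_quat_def open_quat_def)+

end

lemma norm_mult_quat: "norm (x * y) = norm x * norm (y :: quat)"
  unfolding norm_quat_def real_sqrt_mult [symmetric]
  by (simp add: inner_quat_def times_quat_def algebra_simps)

instance quat :: real_normed_algebra_1
proof
  fix x y :: quat and r :: real
  show "(r *\<^sub>R x) * y = r *\<^sub>R (x * y)" "x * (r *\<^sub>R y) = r *\<^sub>R (x * y)"
    by (simp_all add: quat_eq_iff scaleR_quat_def times_quat_def algebra_simps)
  show "norm (x * y) \<le> norm x * norm y"
    by (simp add: norm_mult_quat)
  show "norm (1 :: quat) = 1"
    by (simp add: norm_quat_def inner_quat_def one_quat_def)
qed


section \<open>Conjugation and real part, uniformly for the three scalar types\<close>

class conj_scalar = real_normed_algebra_1 +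
  fixes conj :: "'a \<Rightarrow> 'a"
    and re :: "'a \<Rightarrow> real"
  assumes conj_mult: "conj (x * y) = conj y * conj x"
    and norm_conj: "norm (conj x) = norm x"
    and mult_conj: "x * conj x = (norm x)\<^sup>2 *\<^sub>R 1"
    and add_conj: "x + conj x = (2 * re x) *\<^sub>R 1"

instantiation real :: conj_scalar
begin

definition conj_real :: "real \<Rightarrow> real" where "conj (x :: real) = x"

definition re_real :: "real \<Rightarrow> real" where "re (x :: real) = x"

instance
  by standard (simp_all add: conj_real_def re_real_def power2_eq_square)

end

instantiation complex :: conj_scalar
begin

definition conj_complex :: "complex \<Rightarrow> complex" where "conj (x :: complex) = cnj x"

definition re_complex :: "complex \<Rightarrow> real" where "re (x :: complex) = Re x"

instance
proof
  fix x :: complex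
  show "x * conj x = (norm x)\<^sup>2 *\<^sub>R 1"
    using complex_norm_square [of x] by (simp add: conj_complex_def scaleR_conv_of_real)
qed (simp_all add: conj_complex_def re_complex_def complex_eq_iff)

end

instantiation quat :: conj_scalar
begin

definition conj_quat :: "quat \<Rightarrow> quat" where
  "conj (x :: quat) = Quat (q_re x) (- q_i x) (- q_j x) (- q_k x)"

definition re_quat :: "quat \<Rightarrow> real" where "re (x :: quat) = q_re x"

instance
proof
  fix x y :: quat
  show "conj (x * y) = conj y * conj x"
    by (simp add: conj_quat_def times_quat_def quat_eq_iff algebra_simps)
  show "norm (conj x) = norm x"
    by (simp add: conj_quat_def norm_quat_def inner_quat_def)
  have "(norm x)\<^sup>2 = x \<bullet> x"
    by (rule power2_norm_eq_inner)
  then show "x * conj x = (norm x)\<^sup>2 *\<^sub>R 1"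
    by (simp add: conj_quat_def inner_quat_def times_quat_def scaleR_quat_def one_quat_def)
  show "x + conj x = (2 * re x) *\<^sub>R 1"
    by (simp add: conj_quat_def re_quat_def plus_quat_def scaleR_quat_def one_quat_def)
qed

end


section \<open>The group, the involution and the Cartan model\<close>

definition adj :: "'a::conj_scalar^'n^'m \<Rightarrow> 'a^'m^'n" where
  "adj A = (\<chi> i j. conj (A $ j $ i))"

definition O_group :: "('a::conj_scalar^'n^'n) set" where
  "O_group = {A. A ** adj A = mat 1}"

definition G_group :: "('a::conj_scalar^'n^'n) set" where
  "G_group = connected_component_set O_group (mat 1)"

text \<open>
  The involution is given on the whole matrix algebra; \<^term>\<open>\<sigma> ` G_group = G_group\<close> says that it
  restricts to an automorphism of the group. The identity is not excluded as an involution.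
\<close>

definition cartan_involution :: "('a::conj_scalar^'n^'n \<Rightarrow> 'a^'n^'n) \<Rightarrow> bool" where
  "cartan_involution \<sigma> \<longleftrightarrow>
     linear \<sigma> \<and>
     (\<forall>Y Z. \<sigma> (Y ** Z) = \<sigma> Y ** \<sigma> Z) \<and>
     \<sigma> (mat 1) = mat 1 \<and>
     (\<forall>Y. \<sigma> (\<sigma> Y) = Y) \<and>
     (\<forall>Y. \<sigma> (adj Y) = adj (\<sigma> Y)) \<and>
     \<sigma> ` G_group = G_group"

definition cartan_model :: "('a::conj_scalar^'n^'n \<Rightarrow> 'a^'n^'n) \<Rightarrow> ('a^'n^'n) set" where
  "cartan_model \<sigma> = {B ** matrix_inv (\<sigma> B) | B. B \<in> G_group}"


section \<open>Height functions and critical points\<close>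

definition height :: "'a::conj_scalar^'n^'n \<Rightarrow> 'a^'n^'n \<Rightarrow> real" where
  "height X Y = re (trace (X ** Y))"

text \<open>
  A curve that is defined and \<open>C\<^sup>\<infinity>\<close> near \<open>0\<close>, runs in \<open>S\<close> and passes through \<open>p\<close> at time \<open>0\<close>;
  \<open>D k\<close> is its \<open>k\<close>-th derivative.
\<close>

definition smooth_curve_through ::
    "'b::real_normed_vector set \<Rightarrow> 'b \<Rightarrow> (real \<Rightarrow> 'b) \<Rightarrow> bool" where
  "smooth_curve_through S p \<gamma> \<longleftrightarrow>
     \<gamma> 0 = p \<and>
     (\<exists>\<epsilon>>0. (\<forall>t\<in>{-\<epsilon><..<\<epsilon>}. \<gamma> t \<in> S) \<and>
       (\<exists>D :: nat \<Rightarrow> real \<Rightarrow> 'b. D 0 = \<gamma> \<and>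
         (\<forall>k. \<forall>t\<in>{-\<epsilon><..<\<epsilon>}. (D k has_vector_derivative D (Suc k) t) (at t))))"

text \<open>
  For an embedded submanifold \<open>S\<close> of a Euclidean space, the tangent space at \<open>p\<close> consists of the
  velocities \<open>\<gamma>'(0)\<close> of the smooth curves in \<open>S\<close> through \<open>p\<close>, and the differential of a smooth function
  \<open>f\<close> on \<open>S\<close> sends \<open>\<gamma>'(0)\<close> to \<open>(f \<circ> \<gamma>)'(0)\<close>. A critical point is a point at which this differential
  is zero; only the values of \<open>f\<close> on \<open>S\<close> matter.
\<close>

definition critical_points :: "'b::real_normed_vector set \<Rightarrow> ('b \<Rightarrow> real) \<Rightarrow> 'b set" where
  "critical_points S f =
     {p \<in> S. \<forall>\<gamma>. smooth_curve_through S p \<gamma> \<longrightarrow> ((f \<circ> \<gamma>) has_real_derivative 0) (at 0)}"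

end

theory Submission
  imports Defs
begin

text \<open>
  A curve in \<open>M\<close> is a curve in any set containing \<open>M\<close>, so critical points of a function on the larger
  set that lie in \<open>M\<close> are critical on \<open>M\<close>. Hence everything reduces to \<open>M \<subseteq> G\<close>, that is, to the
  fact that the identity component of \<open>O(n,\<bbbK>)\<close> is closed under products and inverses.
\<close>

lemma critical_points_Int_subset:
  assumes "M \<subseteq> S"
  shows "critical_points S f \<inter> M \<subseteq> critical_points M f"
proof -
  have "smooth_curve_through S p \<gamma>" if "smooth_curve_through M p \<gamma>" for p \<gamma>
    using that assms unfolding smooth_curve_through_def by (blast dest: subsetD)
  then show ?thesis
    unfolding critical_points_def by auto
qed

text \<open>
  The axioms of \<^class>\<open>conj_scalar\<close> do not mention additivity of the conjugation.
\<close>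

class additive_conj_scalar = conj_scalar +
  assumes conj_add: "conj (x + y) = conj x + conj y"

instance real :: additive_conj_scalar
  by standard (simp add: conj_real_def)

instance complex :: additive_conj_scalar
  by standard (simp add: conj_complex_def)

instance quat :: additive_conj_scalar
  by standard (simp add: conj_quat_def plus_quat_def)

lemma additive_conj: "Modules.additive (conj :: 'a::additive_conj_scalar \<Rightarrow> 'a)"
  by (simp add: Modules.additive_def conj_add)

lemmas conj_zero [simp] = Modules.additive.zero [OF additive_conj]
  and conj_diff = Modules.additive.diff [OF additive_conj]
  and conj_sum = Modules.additive.sum [OF additive_conj]

text \<open>For nonzero \<open>r\<close>, \<open>mult_conj\<close> gives
  \<open>r * conj r = r * r\<close>, and the real factor \<open>r\<close> cancels. For
  \<open>r = 0\<close> additivity suffices.\<close>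

lemma conj_of_real [simp]: "conj (of_real r :: 'a::additive_conj_scalar) = of_real r"
proof (cases "r = 0")
  case False
  have "of_real r * conj (of_real r :: 'a) = of_real r * of_real r"
    by (simp add: mult_conj scaleR_conv_of_real power2_eq_square flip: of_real_mult)
  then have "r *\<^sub>R conj (of_real r :: 'a) = r *\<^sub>R of_real r"
    by (simp add: scaleR_conv_of_real)
  with False show ?thesis
    by simp
qed simp

lemma conj_one [simp]: "conj (1 :: 'a::additive_conj_scalar) = 1"
  using conj_of_real [of 1] by simp

text \<open>By \<open>add_conj\<close> the sum \<open>x + conj x\<close> is a real scalar, hence
  fixed by \<open>conj\<close>; additivity then lets \<open>conj x\<close> cancel.\<close>

lemma conj_conj [simp]: "conj (conj x) = (x :: 'a::additive_conj_scalar)"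
proof -
  have "conj (x + conj x) = x + conj x"
    by (simp add: add_conj scaleR_conv_of_real del: of_real_mult of_real_numeral)
  then show ?thesis
    by (simp add: conj_add add.commute)
qed

lemma conj_mult_self: "conj x * x = (norm (x :: 'a::additive_conj_scalar))\<^sup>2 *\<^sub>R 1"
  using mult_conj [of "conj x"] by (simp add: norm_conj)

lemma continuous_on_conj [continuous_intros]:
  fixes f :: "'b::topological_space \<Rightarrow> 'a::additive_conj_scalar"
  assumes "continuous_on S f"
  shows "continuous_on S (\<lambda>x. conj (f x))"
proof -
  have "continuous_on UNIV (conj :: 'a \<Rightarrow> 'a)"
    \<comment> \<open>Being additive and norm-preserving, \<open>conj\<close> is an
      isometry.\<close>
    unfolding continuous_on_iff by (auto simp: dist_norm norm_conj simp flip: conj_diff)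
  then show ?thesis
    using assms continuous_on_compose2 by blast
qed

lemma matrix_sub_ldistrib: "A ** (B - C) = A ** B - A ** (C :: 'a::ring_1^'n^'m)"
  by (simp add: matrix_matrix_mult_def vec_eq_iff right_diff_distrib sum_subtractf)

lemma matrix_sub_rdistrib: "(A - B) ** C = A ** C - B ** (C :: 'a::ring_1^'n^'m)"
  by (simp add: matrix_matrix_mult_def vec_eq_iff left_diff_distrib sum_subtractf)

lemma adj_adj [simp]: "adj (adj A) = (A :: 'a::additive_conj_scalar^'n^'m)"
  by (simp add: adj_def vec_eq_iff)

lemma adj_mat_1 [simp]: "adj (mat 1 :: 'a::additive_conj_scalar^'n^'n) = mat 1"
  by (simp add: adj_def mat_def vec_eq_iff)

lemma adj_diff: "adj (A - B) = adj A - (adj B :: 'a::additive_conj_scalar^'n^'m)"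
  by (simp add: adj_def vec_eq_iff conj_diff)

lemma adj_matrix_mul:
  "adj (A ** B) = adj B ** adj (A :: 'a::additive_conj_scalar^'n^'m)"
  by (simp add: adj_def matrix_matrix_mult_def vec_eq_iff conj_sum conj_mult)

lemma continuous_on_adj [continuous_intros]:
  fixes f :: "'b::topological_space \<Rightarrow> 'a::additive_conj_scalar^'n^'m"
  assumes "continuous_on S f"
  shows "continuous_on S (\<lambda>x. adj (f x))"
  unfolding adj_def by (intro continuous_intros assms)

lemma continuous_on_matrix_mul [continuous_intros]:
  fixes f :: "'b::topological_space \<Rightarrow> 'a::real_normed_algebra_1^'n^'m"
  assumes "continuous_on S f" "continuous_on S g"
  shows "continuous_on S (\<lambda>x. f x ** g x)"
  unfolding matrix_matrix_mult_def by (intro continuous_intros assms)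

text \<open>The diagonal entries are sums of terms \<open>x * conj x\<close>, so the trace is the
  squared Frobenius norm of \<open>A\<close>.\<close>

lemma trace_mul_adj:
  fixes A :: "'a::conj_scalar^'n^'n"
  shows "trace (A ** adj A) = (\<Sum>i\<in>UNIV. \<Sum>j\<in>UNIV. (norm (A $ i $ j))\<^sup>2) *\<^sub>R 1"
  by (simp add: trace_def matrix_matrix_mult_def adj_def mult_conj scaleR_sum_left)

text \<open>The trace is not cyclic over noncommutative scalars. Here both sides are the squared
  Frobenius norm, because \<open>conj x * x = x * conj x\<close>.\<close>

lemma trace_adj_mul:
  fixes A :: "'a::additive_conj_scalar^'n^'n"
  shows "trace (adj A ** A) = trace (A ** adj A)"
proof -
  have "trace (adj A ** A) = (\<Sum>j\<in>UNIV. \<Sum>i\<in>UNIV. (norm (A $ i $ j))\<^sup>2) *\<^sub>R 1"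
    by (simp add: trace_def matrix_matrix_mult_def adj_def conj_mult_self scaleR_sum_left)
  also have "\<dots> = trace (A ** adj A)"
    unfolding trace_mul_adj by (subst sum.swap) (rule refl)
  finally show ?thesis .
qed

lemma trace_mul_adj_eq_0D:
  fixes A :: "'a::conj_scalar^'n^'n"
  assumes "trace (A ** adj A) = 0"
  shows "A = 0"
  using assms
  by (simp add: trace_mul_adj vec_eq_iff sum_nonneg_eq_0_iff sum_nonneg)

lemma mat_1_in_O_group: "mat 1 \<in> (O_group :: ('a::additive_conj_scalar^'n^'n) set)"
  by (simp add: O_group_def)

text \<open>
  Over the quaternions there are no determinants, so that a right inverse is a left inverse is obtained
  from the orthogonal projection \<open>F = 1 - A\<^sup>* A\<close>, whose trace is zero.
\<close>

lemma O_group_adj_mul: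
  fixes A :: "'a::additive_conj_scalar^'n^'n"
  assumes "A \<in> O_group"
  shows "adj A ** A = mat 1"
proof -
  define F where "F = mat 1 - adj A ** A"
  have A: "A ** adj A = mat 1"
    using assms by (simp add: O_group_def)
  have "A ** F = A - (A ** adj A) ** A"
    by (simp add: F_def matrix_sub_ldistrib matrix_mul_assoc)
  then have "A ** F = 0"
    by (simp add: A)
  \<comment> \<open>Expand the left factor only:
    \<open>F ** F = F - adj A ** (A ** F)\<close>.\<close>
  then have "F ** F = F - adj A ** 0"
    by (metis F_def matrix_mul_assoc matrix_mul_lid matrix_sub_rdistrib)
  moreover have "adj F = F"
    by (simp add: F_def adj_diff adj_matrix_mul)
  ultimately have "F ** adj F = F"
    by simp
  then have "trace (F ** adj F) = trace (mat 1 :: 'a^'n^'n) - trace (adj A ** A)"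
    by (simp add: F_def trace_def sum_subtractf)
  \<comment> \<open>The two traces agree, since
    \<open>trace (adj A ** A) = trace (A ** adj A) = trace (mat 1)\<close>. So the Frobenius norm of
    \<open>F\<close> vanishes.\<close>
  then have "F = 0"
    by (intro trace_mul_adj_eq_0D) (simp add: trace_adj_mul A)
  then show ?thesis
    by (simp add: F_def)
qed

lemma O_group_adj:
  assumes "A \<in> O_group"
  shows "adj (A :: 'a::additive_conj_scalar^'n^'n) \<in> O_group"
  using O_group_adj_mul [OF assms] by (simp add: O_group_def)

lemma O_group_mul:
  fixes A B :: "'a::additive_conj_scalar^'n^'n"
  assumes "A \<in> O_group" "B \<in> O_group"
  shows "A ** B \<in> O_group"
proof -
  have "(A ** B) ** adj (A ** B) = A ** (B ** adj B) ** adj A"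
    by (simp add: adj_matrix_mul matrix_mul_assoc)
  with assms show ?thesis
    by (simp add: O_group_def)
qed

lemma O_group_matrix_inv:
  fixes A :: "'a::additive_conj_scalar^'n^'n"
  assumes "A \<in> O_group"
  shows "matrix_inv A = adj A"
proof -
  have "A ** adj A = mat 1 \<and> adj A ** A = mat 1"
    using O_group_adj_mul assms by (simp add: O_group_def)
  \<comment> \<open>\<open>matrix_inv\<close> is a Hilbert choice, so a two-sided inverse must be
    exhibited first; uniqueness of inverses then identifies it with \<open>adj A\<close>.\<close>
  then have "A ** matrix_inv A = mat 1 \<and> matrix_inv A ** A = mat 1"
    unfolding matrix_inv_def by (rule someI)
  with \<open>A ** adj A = mat 1 \<and> adj A ** A = mat 1\<close> show ?thesis
    by (metis matrix_mul_assoc matrix_mul_lid matrix_mul_rid)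
qed

lemma G_group_subset_O_group: "G_group \<subseteq> O_group"
  unfolding G_group_def by (rule connected_component_subset)

lemma mat_1_in_G_group: "mat 1 \<in> (G_group :: ('a::additive_conj_scalar^'n^'n) set)"
  by (simp add: G_group_def mat_1_in_O_group)

text \<open>A component is the component of each of its points, so one common point \<open>B\<close>
  suffices. Both closure properties of \<open>G_group\<close> come from applying this to a
  continuous image of \<open>G_group\<close>.\<close>

lemma connected_subset_G_group:
  fixes T :: "('a::additive_conj_scalar^'n^'n) set"
  assumes "connected T" "T \<subseteq> O_group" "B \<in> T" "B \<in> G_group"
  shows "T \<subseteq> G_group"
  using assms connected_component_maximal [of B T O_group] connected_component_eq [of B O_group "mat 1"]
  unfolding G_group_def by auto

lemma G_group_adj:
  assumes "A \<in> G_group"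
  shows "adj (A :: 'a::additive_conj_scalar^'n^'n) \<in> G_group"
proof -
  have "adj ` G_group \<subseteq> (G_group :: ('a^'n^'n) set)"
  proof (rule connected_subset_G_group)
    show "connected (adj ` (G_group :: ('a^'n^'n) set))"
      unfolding G_group_def
      by (intro connected_continuous_image continuous_intros connected_connected_component)
    show "adj ` G_group \<subseteq> (O_group :: ('a^'n^'n) set)"
      using O_group_adj G_group_subset_O_group by blast
    show "mat 1 \<in> adj ` (G_group :: ('a^'n^'n) set)"
      using mat_1_in_G_group adj_mat_1 by (metis imageI)
  qed (rule mat_1_in_G_group)
  with assms show ?thesis
    by blast
qed

lemma G_group_mul:
  fixes A B :: "'a::additive_conj_scalar^'n^'n"
  assumes "A \<in> G_group" "B \<in> G_group"
  shows "A ** B \<in> G_group"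
proof -
  have "(\<lambda>Y. Y ** B) ` G_group \<subseteq> G_group"
  proof (rule connected_subset_G_group)
    show "connected ((\<lambda>Y. Y ** B) ` G_group)"
      unfolding G_group_def
      by (intro connected_continuous_image continuous_intros connected_connected_component)
    show "(\<lambda>Y. Y ** B) ` G_group \<subseteq> O_group"
      using O_group_mul assms(2) G_group_subset_O_group by blast
    \<comment> \<open>The right translate of \<open>G_group\<close> meets \<open>G_group\<close> at
      \<open>B\<close>, the image of the identity.\<close>
    show "B \<in> (\<lambda>Y. Y ** B) ` G_group"
      using mat_1_in_G_group matrix_mul_lid by (metis image_eqI)
  qed (rule assms(2))
  with assms(1) show ?thesis
    by blast
qed

lemma cartan_model_subset_G_group:
  fixes \<sigma> :: "'a::additive_conj_scalar^'n^'n \<Rightarrow> 'a^'n^'n"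
  assumes "cartan_involution \<sigma>"
  shows "cartan_model \<sigma> \<subseteq> G_group"
proof -
  have "B ** matrix_inv (\<sigma> B) \<in> G_group" if "B \<in> G_group" for B
  proof -
    \<comment> \<open>This puts \<open>\<sigma> B\<close> in \<open>O_group\<close>, so its inverse
      is \<open>adj (\<sigma> B)\<close>, which stays in \<open>G_group\<close>.\<close>
    have "\<sigma> B \<in> G_group"
      using assms that by (auto simp: cartan_involution_def)
    with that show ?thesis
      using G_group_subset_O_group O_group_matrix_inv [of "\<sigma> B"] G_group_adj G_group_mul
      by (metis subsetD)
  qed
  then show ?thesis
    by (auto simp: cartan_model_def)
qed

theorem corollary2p8:
  "(\<forall>(\<sigma> :: real^'n^'n \<Rightarrow> real^'n^'n) X.
      cartan_involution \<sigma> \<and> X \<noteq> 0 \<longrightarrow>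
      critical_points G_group (height X) \<inter> cartan_model \<sigma>
        \<subseteq> critical_points (cartan_model \<sigma>) (height X)) \<and>
   (\<forall>(\<sigma> :: complex^'n^'n \<Rightarrow> complex^'n^'n) X.
      cartan_involution \<sigma> \<and> X \<noteq> 0 \<longrightarrow>
      critical_points G_group (height X) \<inter> cartan_model \<sigma>
        \<subseteq> critical_points (cartan_model \<sigma>) (height X)) \<and>
   (\<forall>(\<sigma> :: quat^'n^'n \<Rightarrow> quat^'n^'n) X.
      cartan_involution \<sigma> \<and> X \<noteq> 0 \<longrightarrow>
      critical_points G_group (height X) \<inter> cartan_model \<sigma>
        \<subseteq> critical_points (cartan_model \<sigma>) (height X))"
  by (intro conjI allI impI critical_points_Int_subset cartan_model_subset_G_group) auto

end
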